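(* Let $(A,\bullet)$ be a mock-Lie algebra, $(V,\rho)$ a representation of $A$, and $(V^*,\rho^* )$ the dual representation. Let $T:V\to A$ be a linear map, identified with the element $T=\sum_{i=1}^m T(v_i)\otimes v_i^*\in A\otimes V^*\subset(A\ltimes_{\rho^*}V^* )\otimes(A\ltimes_{\rho^*}V^* )$, where $\{v_1,\dots,v_m\}$ is a basis of $V$ and $\{v_1^*,\dots,v_m^*\}$ is the dual basis of $V^*$. Then $r=T-\tau(T)$ is a skew-symmetric solution of the mock-Lie Yang-Baxter equation in the semi-direct product mock-Lie algebra $A\ltimes_{\rho^*}V^*$ if and only if $T$ is an $\mathcal{O}$-operator associated to $(V,\rho)$.
   Context: All vector spaces are finite-dimensional over a field $\mathbb{K}$ of characteristic zero. A mock-Lie algebra $(A,\bullet)$ is a vector space with a bilinear product that is commutative and satisfies $x\bullet(y\bullet z)+y\bullet(z\bullet x)+z\bullet(x\bullet y)=0$. A representation $(V,\rho)$ of $A$ is a vector space $V$ with a linear map $\rho:A\to\mathrm{End}(V)$ such that $\rho(x\bullet y)=-\rho(x)\rho(y)-\rho(y)\rho(x)$. Its dual representation $\rho^*:A\to\mathrm{End}(V^* )$ is given by $\langle\rho^*(x)u^*,v\rangle=\langle u^*,\rho(x)v\rangle$. The semi-direct product $A\ltimes_{\rho^*}V^*$ is the mock-Lie algebra $A\oplus V^*$ with product $(x+u^* )\bullet(y+v^* )=x\bullet y+\rho^*(x)v^*+\rho^*(y)u^*$. A linear map $T:V\to A$ is an $\mathcal{O}$-operator associated to $(V,\rho)$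 if $T(u)\bullet T(v)=T(\rho(Tu)v+\rho(Tv)u)$ for all $u,v\in V$. $\tau$ is the flip $\tau(u\otimes v)=v\otimes u$; a tensor $r$ is skew-symmetric if $r=-\tau(r)$. For a mock-Lie algebra $(B,\bullet)$ and $r=\sum_i a_i\otimes b_i\in B\otimes B$, the mock-Lie Yang-Baxter equation in $B$ is $[[r,r]]:=r_{12}\bullet r_{13}+r_{13}\bullet r_{23}-r_{12}\bullet r_{23}=0$, where $r_{12}\bullet r_{13}=\sum_{i,j}(a_i\bullet a_j)\otimes b_i\otimes b_j$, $r_{13}\bullet r_{23}=\sum_{i,j}a_i\otimes a_j\otimes(b_i\bullet b_j)$, $r_{12}\bullet r_{23}=\sum_{i,j}a_i\otimes(b_i\bullet a_j)\otimes b_j$. *)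

theory Defs
  imports Complex_Main "HOL-Library.Function_Algebras" "HOL-Library.Product_Plus"
begin

section \<open>Pointwise and componentwise scalar multiplication, dual space\<close>

definition fun_scale :: "'k::field \<Rightarrow> ('x \<Rightarrow> 'k) \<Rightarrow> ('x \<Rightarrow> 'k)" where
  "fun_scale c f = (\<lambda>x. c * f x)"

definition prod_scale :: "('k \<Rightarrow> 'a \<Rightarrow> 'a) \<Rightarrow> ('k \<Rightarrow> 'b \<Rightarrow> 'b) \<Rightarrow> 'k \<Rightarrow> 'a \<times> 'b \<Rightarrow> 'a \<times> 'b" where
  "prod_scale s t c p = (s c (fst p), t c (snd p))"

definition dual_space :: "('k::field \<Rightarrow> 'v::ab_group_add \<Rightarrow> 'v) \<Rightarrow> ('v \<Rightarrow> 'k) set" where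
  "dual_space s = {f. Vector_Spaces.linear s (*) f}"

definition finite_dim_subspace :: "('k::field \<Rightarrow> 'b::ab_group_add \<Rightarrow> 'b) \<Rightarrow> 'b set \<Rightarrow> bool" where
  "finite_dim_subspace s B \<longleftrightarrow> vector_space s \<and> (\<exists>S. finite S \<and> module.span s S = B)"

lemma prod_scale_Pair: "prod_scale s t c (x, y) = (s c x, t c y)"
  by (simp add: prod_scale_def)

lemma vector_space_fun_scale: "vector_space fun_scale"
  by unfold_locales (auto simp: fun_scale_def algebra_simps fun_eq_iff)

lemma vector_space_prod_scale:
  assumes "vector_space s" "vector_space t" shows "vector_space (prod_scale s t)"
proof -
  interpret s: vector_space s by fact
  interpret t: vector_space t by fact
  show ?thesis
    by unfold_locales
      (auto simp: prod_scale_def s.scale_right_distrib t.scale_right_distrib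
        s.scale_left_distrib t.scale_left_distrib)
qed


section \<open>Multilinear maps on a subspace\<close>

definition linear_on :: "('k \<Rightarrow> 'b::plus \<Rightarrow> 'b) \<Rightarrow> ('k \<Rightarrow> 'w::plus \<Rightarrow> 'w) \<Rightarrow> 'b set \<Rightarrow> ('b \<Rightarrow> 'w) \<Rightarrow> bool" where
  "linear_on s t B f \<longleftrightarrow>
     (\<forall>x\<in>B. \<forall>y\<in>B. f (x + y) = f x + f y) \<and> (\<forall>c. \<forall>x\<in>B. f (s c x) = t c (f x))"

definition bilinear_on ::
    "('k \<Rightarrow> 'b::plus \<Rightarrow> 'b) \<Rightarrow> ('k \<Rightarrow> 'w::plus \<Rightarrow> 'w) \<Rightarrow> 'b set \<Rightarrow> ('b \<Rightarrow> 'b \<Rightarrow> 'w) \<Rightarrow> bool" where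
  "bilinear_on s t B f \<longleftrightarrow>
     (\<forall>y\<in>B. linear_on s t B (\<lambda>x. f x y)) \<and> (\<forall>x\<in>B. linear_on s t B (\<lambda>y. f x y))"

definition trilinear_on ::
    "('k \<Rightarrow> 'b::plus \<Rightarrow> 'b) \<Rightarrow> ('k \<Rightarrow> 'w::plus \<Rightarrow> 'w) \<Rightarrow> 'b set \<Rightarrow> ('b \<Rightarrow> 'b \<Rightarrow> 'b \<Rightarrow> 'w) \<Rightarrow> bool" where
  "trilinear_on s t B f \<longleftrightarrow>
     (\<forall>y\<in>B. \<forall>z\<in>B. linear_on s t B (\<lambda>x. f x y z)) \<and>
     (\<forall>x\<in>B. \<forall>z\<in>B. linear_on s t B (\<lambda>y. f x y z)) \<and>
     (\<forall>x\<in>B. \<forall>y\<in>B. linear_on s t B (\<lambda>z. f x y z))"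


section \<open>Mock-Lie algebras, representations, semi-direct products\<close>

text \<open>The algebra lives on a subspace \<open>B\<close> of an ambient vector space, because the semi-direct
  product has the carrier \<open>A \<times> V\<^sup>*\<close>, where \<open>V\<^sup>*\<close> is a proper subset of all functions on \<open>V\<close>.\<close>

definition mock_lie_algebra ::
    "('k::field_char_0 \<Rightarrow> 'b::ab_group_add \<Rightarrow> 'b) \<Rightarrow> 'b set \<Rightarrow> ('b \<Rightarrow> 'b \<Rightarrow> 'b) \<Rightarrow> bool" where
  "mock_lie_algebra s B m \<longleftrightarrow>
     finite_dim_subspace s B \<and>
     (\<forall>x\<in>B. \<forall>y\<in>B. m x y \<in> B) \<and>
     bilinear_on s s B m \<and>
     (\<forall>x\<in>B. \<forall>y\<in>B. m x y = m y x) \<and>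
     (\<forall>x\<in>B. \<forall>y\<in>B. \<forall>z\<in>B. m x (m y z) + m y (m z x) + m z (m x y) = 0)"

definition mock_lie_representation ::
    "('k::field_char_0 \<Rightarrow> 'a::ab_group_add \<Rightarrow> 'a) \<Rightarrow> ('a \<Rightarrow> 'a \<Rightarrow> 'a) \<Rightarrow>
     ('k \<Rightarrow> 'v::ab_group_add \<Rightarrow> 'v) \<Rightarrow> ('a \<Rightarrow> 'v \<Rightarrow> 'v) \<Rightarrow> bool" where
  "mock_lie_representation sA m sV \<rho> \<longleftrightarrow>
     finite_dim_subspace sV UNIV \<and>
     (\<forall>x. Vector_Spaces.linear sV sV (\<rho> x)) \<and>
     (\<forall>v. Vector_Spaces.linear sA sV (\<lambda>x. \<rho> x v)) \<and>
     (\<forall>x y v. \<rho> (m x y) v = - \<rho> x (\<rho> y v) - \<rho> y (\<rho> x v))"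

definition dual_rep :: "('a \<Rightarrow> 'v \<Rightarrow> 'v) \<Rightarrow> 'a \<Rightarrow> ('v \<Rightarrow> 'k) \<Rightarrow> ('v \<Rightarrow> 'k)" where
  "dual_rep \<rho> x u = (\<lambda>v. u (\<rho> x v))"

definition semidirect_carrier ::
    "('k::field \<Rightarrow> 'v::ab_group_add \<Rightarrow> 'v) \<Rightarrow> ('a \<times> ('v \<Rightarrow> 'k)) set" where
  "semidirect_carrier sV = UNIV \<times> dual_space sV"

definition semidirect_mult ::
    "('a \<Rightarrow> 'a \<Rightarrow> 'a) \<Rightarrow> ('a \<Rightarrow> 'v \<Rightarrow> 'v) \<Rightarrow>
     'a \<times> ('v \<Rightarrow> 'k::ab_group_add) \<Rightarrow> 'a \<times> ('v \<Rightarrow> 'k) \<Rightarrow> 'a \<times> ('v \<Rightarrow> 'k)" where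
  "semidirect_mult m \<rho> p q =
     (m (fst p) (fst q), dual_rep \<rho> (fst p) (snd q) + dual_rep \<rho> (fst q) (snd p))"

definition O_operator ::
    "('k::field_char_0 \<Rightarrow> 'a::ab_group_add \<Rightarrow> 'a) \<Rightarrow> ('a \<Rightarrow> 'a \<Rightarrow> 'a) \<Rightarrow>
     ('k \<Rightarrow> 'v::ab_group_add \<Rightarrow> 'v) \<Rightarrow> ('a \<Rightarrow> 'v \<Rightarrow> 'v) \<Rightarrow> ('v \<Rightarrow> 'a) \<Rightarrow> bool" where
  "O_operator sA m sV \<rho> T \<longleftrightarrow>
     Vector_Spaces.linear sV sA T \<and>
     (\<forall>u v. m (T u) (T v) = T (\<rho> (T u) v + \<rho> (T v) u))"


section \<open>Tensors\<close>

text \<open>For a finite-dimensional space \<open>B\<close> we use the classical model of \<open>B \<otimes> B\<close> as the dual of the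
  space of bilinear forms on \<open>B\<close>, the pure tensor \<open>a \<otimes> b\<close> being evaluation of a form at
  \<open>(a, b)\<close>; likewise \<open>B \<otimes> B \<otimes> B\<close> with trilinear forms. Forms are functions on the ambient type, so
  a tensor is set to 0 on functions that are not bilinear (trilinear) on \<open>B\<close>. The universal
  property is proved below (\<open>tensor2_universal\<close>, \<open>tensor3_universal\<close>).\<close>

type_synonym ('b, 'k) tensor2 = "('b \<Rightarrow> 'b \<Rightarrow> 'k) \<Rightarrow> 'k"
type_synonym ('b, 'k) tensor3 = "('b \<Rightarrow> 'b \<Rightarrow> 'b \<Rightarrow> 'k) \<Rightarrow> 'k"

definition tens2 ::
    "('k::field \<Rightarrow> 'b::ab_group_add \<Rightarrow> 'b) \<Rightarrow> 'b set \<Rightarrow> 'b \<Rightarrow> 'b \<Rightarrow> ('b, 'k) tensor2" where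
  "tens2 s B a b = (\<lambda>\<phi>. if bilinear_on s (*) B \<phi> then \<phi> a b else 0)"

definition tens3 ::
    "('k::field \<Rightarrow> 'b::ab_group_add \<Rightarrow> 'b) \<Rightarrow> 'b set \<Rightarrow> 'b \<Rightarrow> 'b \<Rightarrow> 'b \<Rightarrow> ('b, 'k) tensor3" where
  "tens3 s B a b c = (\<lambda>\<phi>. if trilinear_on s (*) B \<phi> then \<phi> a b c else 0)"

definition tensor_square ::
    "('k::field \<Rightarrow> 'b::ab_group_add \<Rightarrow> 'b) \<Rightarrow> 'b set \<Rightarrow> ('b, 'k) tensor2 set" where
  "tensor_square s B = module.span fun_scale {tens2 s B a b | a b. a \<in> B \<and> b \<in> B}"

definition flip :: "('b, 'k) tensor2 \<Rightarrow> ('b, 'k) tensor2" where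
  "flip t = (\<lambda>\<phi>. t (\<lambda>x y. \<phi> y x))"

text \<open>If \<open>r = (\<Sum>i. a\<^sub>i \<otimes> b\<^sub>i)\<close> then \<open>r (\<lambda>a b. r (\<lambda>a' b'. F a b a' b')) = (\<Sum>i j. F a\<^sub>i b\<^sub>i a\<^sub>j b\<^sub>j)\<close>.
  This gives the three leg products without choosing a decomposition of \<open>r\<close>; the formulas for a
  given decomposition are \<open>r12_r13_sum\<close>, \<open>r13_r23_sum\<close> and \<open>r12_r23_sum\<close> below.\<close>

definition r12_r13 ::
    "('k::field \<Rightarrow> 'b::ab_group_add \<Rightarrow> 'b) \<Rightarrow> 'b set \<Rightarrow> ('b \<Rightarrow> 'b \<Rightarrow> 'b) \<Rightarrow> ('b, 'k) tensor2 \<Rightarrow> ('b, 'k) tensor3" where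
  "r12_r13 s B m r = (\<lambda>\<phi>. if trilinear_on s (*) B \<phi>
     then r (\<lambda>a b. r (\<lambda>a' b'. \<phi> (m a a') b b')) else 0)"

definition r13_r23 ::
    "('k::field \<Rightarrow> 'b::ab_group_add \<Rightarrow> 'b) \<Rightarrow> 'b set \<Rightarrow> ('b \<Rightarrow> 'b \<Rightarrow> 'b) \<Rightarrow> ('b, 'k) tensor2 \<Rightarrow> ('b, 'k) tensor3" where
  "r13_r23 s B m r = (\<lambda>\<phi>. if trilinear_on s (*) B \<phi>
     then r (\<lambda>a b. r (\<lambda>a' b'. \<phi> a a' (m b b'))) else 0)"

definition r12_r23 ::
    "('k::field \<Rightarrow> 'b::ab_group_add \<Rightarrow> 'b) \<Rightarrow> 'b set \<Rightarrow> ('b \<Rightarrow> 'b \<Rightarrow> 'b) \<Rightarrow> ('b, 'k) tensor2 \<Rightarrow> ('b, 'k) tensor3" where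
  "r12_r23 s B m r = (\<lambda>\<phi>. if trilinear_on s (*) B \<phi>
     then r (\<lambda>a b. r (\<lambda>a' b'. \<phi> a (m b a') b')) else 0)"

definition yang_baxter ::
    "('k::field \<Rightarrow> 'b::ab_group_add \<Rightarrow> 'b) \<Rightarrow> 'b set \<Rightarrow> ('b \<Rightarrow> 'b \<Rightarrow> 'b) \<Rightarrow> ('b, 'k) tensor2 \<Rightarrow> ('b, 'k) tensor3" where
  "yang_baxter s B m r = r12_r13 s B m r + r13_r23 s B m r - r12_r23 s B m r"

definition skew_symmetric_MLYBE_solution ::
    "('k::field_char_0 \<Rightarrow> 'b::ab_group_add \<Rightarrow> 'b) \<Rightarrow> 'b set \<Rightarrow> ('b \<Rightarrow> 'b \<Rightarrow> 'b) \<Rightarrow> ('b, 'k) tensor2 \<Rightarrow> bool" where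
  "skew_symmetric_MLYBE_solution s B m r \<longleftrightarrow>
     r \<in> tensor_square s B \<and> r = - flip r \<and> yang_baxter s B m r = 0"


section \<open>Adequacy of the encoding\<close>

lemma sum_fun_apply: "(\<Sum>i\<in>I. f i) x = (\<Sum>i\<in>I. f i x)" for f :: "'i \<Rightarrow> 'x \<Rightarrow> 'k::comm_monoid_add"
  by (induction I rule: infinite_finite_induct) auto

lemma linear_on_sum:
  assumes "finite I" "\<And>i. i \<in> I \<Longrightarrow> linear_on s (*) B (f i)"
  shows "linear_on s (*) B (\<lambda>x. \<Sum>i\<in>I. f i x :: 'k::field)"
  using assms by (induction I rule: finite_induct) (auto simp: linear_on_def algebra_simps)

lemma linear_char:
  "Vector_Spaces.linear s t f \<longleftrightarrow> vector_space s \<and> vector_space t \<and>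
     (\<forall>x y. f (x + y) = f x + f y) \<and> (\<forall>c x. f (s c x) = t c (f x))"
  unfolding Vector_Spaces.linear_def module_hom_def module_hom_axioms_def
  by (auto simp: vector_space_def module_def)

lemma flip_tens2: "flip (tens2 s B a b) = tens2 s B b a"
  by (auto simp: flip_def tens2_def bilinear_on_def fun_eq_iff)

context
  fixes s :: "'k::field_char_0 \<Rightarrow> 'b::ab_group_add \<Rightarrow> 'b" and B m
  assumes alg: "mock_lie_algebra s B m"
begin

lemma mult_closed: "x \<in> B \<Longrightarrow> y \<in> B \<Longrightarrow> m x y \<in> B"
  using alg by (auto simp: mock_lie_algebra_def)

lemma mult_bilin: "bilinear_on s s B m"
  using alg by (auto simp: mock_lie_algebra_def)

lemma leg_sum_aux:
  assumes I: "finite I" and ab: "\<And>i. i \<in> I \<Longrightarrow> a i \<in> B \<and> b i \<in> B"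
    and F1: "\<And>x y. x \<in> B \<Longrightarrow> y \<in> B \<Longrightarrow> bilinear_on s (*) B (F x y)"
    and F2: "\<And>x y. x \<in> B \<Longrightarrow> y \<in> B \<Longrightarrow> bilinear_on s (*) B (\<lambda>u v. F u v x y)"
    and r: "r = (\<Sum>i\<in>I. tens2 s B (a i) (b i))"
  shows "r (\<lambda>x y. r (F x y)) = (\<Sum>i\<in>I. \<Sum>j\<in>I. F (a i) (b i) (a j) (b j))"
proof -
  have ev: "r \<phi> = (\<Sum>i\<in>I. \<phi> (a i) (b i))" if "bilinear_on s (*) B \<phi>" for \<phi>
    using that by (simp add: r sum_fun_apply tens2_def)
  have inner: "r (F x y) = (\<Sum>j\<in>I. F x y (a j) (b j))" if "x \<in> B" "y \<in> B" for x y
    using ev[OF F1[OF that]] .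
  have F3: "bilinear_on s (*) B (\<lambda>x y. \<Sum>j\<in>I. F x y (a j) (b j))"
    using F2 ab I by (auto simp: bilinear_on_def intro!: linear_on_sum)
  have vs: "vector_space s" and "\<exists>S. module.span s S = B"
    using alg by (auto simp: mock_lie_algebra_def finite_dim_subspace_def)
  then interpret vector_space s by simp
  have sub: "subspace B" using \<open>\<exists>S. span S = B\<close> subspace_span by auto
  have "bilinear_on s (*) B (\<lambda>x y. r (F x y))"
    using F3 inner sub by (auto simp: bilinear_on_def linear_on_def subspace_add subspace_scale)
  from ev[OF this] show ?thesis using ab inner by (auto intro!: sum.cong)
qed

lemma r12_r13_sum:
  assumes "finite I" "\<And>i. i \<in> I \<Longrightarrow> a i \<in> B \<and> b i \<in> B"
  shows "r12_r13 s B m (\<Sum>i\<in>I. tens2 s B (a i) (b i)) =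
     (\<Sum>i\<in>I. \<Sum>j\<in>I. tens3 s B (m (a i) (a j)) (b i) (b j))"
proof (rule ext)
  fix \<phi>
  show "r12_r13 s B m (\<Sum>i\<in>I. tens2 s B (a i) (b i)) \<phi> =
     (\<Sum>i\<in>I. \<Sum>j\<in>I. tens3 s B (m (a i) (a j)) (b i) (b j)) \<phi>"
  proof (cases "trilinear_on s (*) B \<phi>")
    case True
    define r where "r = (\<Sum>i\<in>I. tens2 s B (a i) (b i))"
    show ?thesis
      unfolding r_def[symmetric] unfolding r12_r13_def tens3_def sum_fun_apply using True
      by (simp, intro leg_sum_aux[OF assms _ _ r_def, where F = "\<lambda>x y x' y'. \<phi> (m x x') y y'"])
        (use mult_closed mult_bilin in \<open>auto simp: bilinear_on_def trilinear_on_def linear_on_def\<close>)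
  qed (simp add: r12_r13_def tens3_def sum_fun_apply)
qed

lemma r13_r23_sum:
  assumes "finite I" "\<And>i. i \<in> I \<Longrightarrow> a i \<in> B \<and> b i \<in> B"
  shows "r13_r23 s B m (\<Sum>i\<in>I. tens2 s B (a i) (b i)) =
     (\<Sum>i\<in>I. \<Sum>j\<in>I. tens3 s B (a i) (a j) (m (b i) (b j)))"
proof (rule ext)
  fix \<phi>
  show "r13_r23 s B m (\<Sum>i\<in>I. tens2 s B (a i) (b i)) \<phi> =
     (\<Sum>i\<in>I. \<Sum>j\<in>I. tens3 s B (a i) (a j) (m (b i) (b j))) \<phi>"
  proof (cases "trilinear_on s (*) B \<phi>")
    case True
    define r where "r = (\<Sum>i\<in>I. tens2 s B (a i) (b i))"
    show ?thesis
      unfolding r_def[symmetric] unfolding r13_r23_def tens3_def sum_fun_apply using True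
      by (simp, intro leg_sum_aux[OF assms _ _ r_def, where F = "\<lambda>x y x' y'. \<phi> x x' (m y y')"])
        (use mult_closed mult_bilin in \<open>auto simp: bilinear_on_def trilinear_on_def linear_on_def\<close>)
  qed (simp add: r13_r23_def tens3_def sum_fun_apply)
qed

lemma r12_r23_sum:
  assumes "finite I" "\<And>i. i \<in> I \<Longrightarrow> a i \<in> B \<and> b i \<in> B"
  shows "r12_r23 s B m (\<Sum>i\<in>I. tens2 s B (a i) (b i)) =
     (\<Sum>i\<in>I. \<Sum>j\<in>I. tens3 s B (a i) (m (b i) (a j)) (b j))"
proof (rule ext)
  fix \<phi>
  show "r12_r23 s B m (\<Sum>i\<in>I. tens2 s B (a i) (b i)) \<phi> =
     (\<Sum>i\<in>I. \<Sum>j\<in>I. tens3 s B (a i) (m (b i) (a j)) (b j)) \<phi>"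
  proof (cases "trilinear_on s (*) B \<phi>")
    case True
    define r where "r = (\<Sum>i\<in>I. tens2 s B (a i) (b i))"
    show ?thesis
      unfolding r_def[symmetric] unfolding r12_r23_def tens3_def sum_fun_apply using True
      by (simp, intro leg_sum_aux[OF assms _ _ r_def, where F = "\<lambda>x y x' y'. \<phi> x (m y x') y'"])
        (use mult_closed mult_bilin in \<open>auto simp: bilinear_on_def trilinear_on_def linear_on_def\<close>)
  qed (simp add: r12_r23_def tens3_def sum_fun_apply)
qed

end

lemma tens2_bilinear: "bilinear_on s fun_scale B (tens2 s B)"
  by (auto simp: bilinear_on_def linear_on_def tens2_def fun_scale_def fun_eq_iff)

lemma tens3_trilinear: "trilinear_on s fun_scale B (tens3 s B)"
  by (auto simp: trilinear_on_def linear_on_def tens3_def fun_scale_def fun_eq_iff)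

lemma finite_dim_subspace_coordinates:
  assumes "finite_dim_subspace s B"
  obtains E c where "finite E" "E \<subseteq> B" "\<And>e. linear_on s (*) B (c e)"
    "\<forall>x\<in>B. x = (\<Sum>e\<in>E. s (c e x) e)"
proof -
  from assms obtain S where S: "finite S" "module.span s S = B" and vs: "vector_space s"
    by (auto simp: finite_dim_subspace_def)
  interpret vector_space s by fact
  obtain E where E: "E \<subseteq> S" "independent E" "S \<subseteq> span E"
    using maximal_independent_subset[of S] by metis
  have sp: "span E = B"
    using E S by (metis span_mono span_minimal subspace_span subset_antisym)
  have fin: "finite E" using E S finite_subset by blast
  show thesis
  proof
    show "finite E" by fact
    show "E \<subseteq> B" using sp span_superset by auto
    show "linear_on s (*) B (\<lambda>x. representation E x e)" for e
      using E sp by (auto simp: linear_on_def representation_add representation_scale)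
    show "\<forall>x\<in>B. x = (\<Sum>e\<in>E. s (representation E x e) e)"
      using sum_representation_eq[of E _ E] E fin sp by auto
  qed
qed

lemma linear_on_sum_expand:
  assumes "finite_dim_subspace s B" "vector_space t" "linear_on s t B f"
    and "finite E" "E \<subseteq> B"
  shows "f (\<Sum>e\<in>E. s (c e) e) = (\<Sum>e\<in>E. t (c e) (f e))"
proof -
  interpret s: vector_space s using assms by (auto simp: finite_dim_subspace_def)
  interpret t: vector_space t by fact
  have sub: "s.subspace B" using assms by (auto simp: finite_dim_subspace_def)
  have "f 0 = 0"
    using assms(3) s.subspace_0[OF sub] by (metis add_cancel_left_left add_0 linear_on_def)
  with assms(4,5) show ?thesis
  proof (induction E rule: finite_induct)
    case (insert e E)
    then have "s (c e) e \<in> B" "(\<Sum>e\<in>E. s (c e) e) \<in> B" "e \<in> B"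
      using sub by (auto intro!: s.subspace_sum s.subspace_scale)
    with insert assms(3) show ?case by (auto simp: linear_on_def)
  qed simp
qed

lemma tensor2_universal:
  assumes fd: "finite_dim_subspace s B" and t: "vector_space t" and f: "bilinear_on s t B f"
  shows "\<exists>F. Vector_Spaces.linear fun_scale t F \<and> (\<forall>a\<in>B. \<forall>b\<in>B. F (tens2 s B a b) = f a b)"
proof -
  obtain E c where E: "finite E" "E \<subseteq> B" and c: "\<And>e. linear_on s (*) B (c e)"
    and x: "\<forall>x\<in>B. x = (\<Sum>e\<in>E. s (c e x) e)"
    using finite_dim_subspace_coordinates[OF fd] by blast
  interpret t: vector_space t by fact
  interpret vector_space_pair fun_scale t
    using vector_space_fun_scale t by (auto simp: vector_space_pair_def)
  define F where "F z = (\<Sum>e\<in>E. \<Sum>e'\<in>E. t (z (\<lambda>x y. c e x * c e' y)) (f e e'))" for z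
  have lin: "Vector_Spaces.linear fun_scale t F"
    unfolding linear_char using t vector_space_fun_scale
    by (auto simp: F_def fun_scale_def t.scale_left_distrib sum.distrib t.scale_sum_right)
  have b: "bilinear_on s (*) B (\<lambda>x y. c e x * c e' y)" for e e'
    using c by (auto simp: bilinear_on_def linear_on_def algebra_simps)
  have "F (tens2 s B a b) = f a b" if "a \<in> B" "b \<in> B" for a b
  proof -
    have 1: "f a b = (\<Sum>e\<in>E. t (c e a) (f e b))"
      using linear_on_sum_expand[OF fd t _ E, of "\<lambda>x. f x b" "\<lambda>e. c e a", folded x[rule_format, OF that(1)]] f E that
      by (simp add: bilinear_on_def)
    have 2: "f e b = (\<Sum>e'\<in>E. t (c e' b) (f e e'))" if "e \<in> E" for e
      using linear_on_sum_expand[OF fd t _ E, of "\<lambda>y. f e y" "\<lambda>e'. c e' b", folded x[rule_format, OF \<open>b \<in> B\<close>]] f E that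
      by (auto simp: bilinear_on_def)
    show ?thesis
      unfolding 1 by (simp add: 2 F_def tens2_def b t.scale_sum_right)
  qed
  with lin show ?thesis by blast
qed

lemma tensor3_universal:
  assumes fd: "finite_dim_subspace s B" and t: "vector_space t" and f: "trilinear_on s t B f"
  shows "\<exists>F. Vector_Spaces.linear fun_scale t F \<and>
    (\<forall>a\<in>B. \<forall>b\<in>B. \<forall>d\<in>B. F (tens3 s B a b d) = f a b d)"
proof -
  obtain E c where E: "finite E" "E \<subseteq> B" and c: "\<And>e. linear_on s (*) B (c e)"
    and x: "\<forall>x\<in>B. x = (\<Sum>e\<in>E. s (c e x) e)"
    using finite_dim_subspace_coordinates[OF fd] by blast
  interpret t: vector_space t by fact
  interpret vector_space_pair fun_scale t
    using vector_space_fun_scale t by (auto simp: vector_space_pair_def)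
  define F where "F z = (\<Sum>e\<in>E. \<Sum>e'\<in>E. \<Sum>e''\<in>E.
    t (z (\<lambda>x y w. c e x * c e' y * c e'' w)) (f e e' e''))" for z
  have lin: "Vector_Spaces.linear fun_scale t F"
    unfolding linear_char using t vector_space_fun_scale
    by (auto simp: F_def fun_scale_def t.scale_left_distrib sum.distrib t.scale_sum_right)
  have b: "trilinear_on s (*) B (\<lambda>x y w. c e x * c e' y * c e'' w)" for e e' e''
    using c by (auto simp: trilinear_on_def linear_on_def algebra_simps)
  have "F (tens3 s B a b d) = f a b d" if "a \<in> B" "b \<in> B" "d \<in> B" for a b d
  proof -
    have 1: "f a b d = (\<Sum>e\<in>E. t (c e a) (f e b d))"
      using linear_on_sum_expand[OF fd t _ E, of "\<lambda>x. f x b d" "\<lambda>e. c e a", folded x[rule_format, OF that(1)]] f E that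
      by (simp add: trilinear_on_def)
    have 2: "f e b d = (\<Sum>e'\<in>E. t (c e' b) (f e e' d))" if "e \<in> E" for e
      using linear_on_sum_expand[OF fd t _ E, of "\<lambda>y. f e y d" "\<lambda>e'. c e' b", folded x[rule_format, OF \<open>b \<in> B\<close>]] f E that \<open>d \<in> B\<close>
      by (auto simp: trilinear_on_def)
    have 3: "f e e' d = (\<Sum>e''\<in>E. t (c e'' d) (f e e' e''))" if "e \<in> E" "e' \<in> E" for e e'
      using linear_on_sum_expand[OF fd t _ E, of "\<lambda>y. f e e' y" "\<lambda>e'. c e' d", folded x[rule_format, OF \<open>d \<in> B\<close>]] f E that
      by (simp add: trilinear_on_def subset_iff)
    show ?thesis
      unfolding 1 by (simp add: 2 3 F_def tens3_def b[unfolded mult.assoc] t.scale_sum_right mult.assoc)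
  qed
  with lin show ?thesis by blast
qed

lemma dual_space_iff:
  fixes sV :: "'k::field \<Rightarrow> 'v::ab_group_add \<Rightarrow> 'v"
  assumes "vector_space sV"
  shows "f \<in> dual_space sV \<longleftrightarrow>
    (\<forall>x y. f (x + y) = f x + f y) \<and> (\<forall>c x. f (sV c x) = c * f x)"
proof -
  have "vector_space ((*) :: 'k \<Rightarrow> 'k \<Rightarrow> 'k)" by unfold_locales (auto simp: algebra_simps)
  with assms show ?thesis by (simp add: dual_space_def linear_char)
qed

lemma dual_space_subspace:
  assumes "vector_space sV" shows "module.subspace fun_scale (dual_space sV)"
proof -
  interpret fs: vector_space fun_scale by (rule vector_space_fun_scale)
  show ?thesis
    unfolding fs.subspace_def
    by (auto simp: dual_space_iff[OF assms] fun_scale_def distrib_left)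
qed

lemma finite_dim_semidirect_carrier:
  fixes sA :: "'k::field \<Rightarrow> 'a::ab_group_add \<Rightarrow> 'a" and sV :: "'k \<Rightarrow> 'v::ab_group_add \<Rightarrow> 'v"
  assumes A: "finite_dim_subspace sA UNIV" and V: "finite_dim_subspace sV UNIV"
  shows "finite_dim_subspace (prod_scale sA fun_scale) (semidirect_carrier sV)"
proof -
  have vs: "vector_space sA" "vector_space sV" using A V by (auto simp: finite_dim_subspace_def)
  interpret a: vector_space sA by fact
  interpret v: vector_space sV by fact
  interpret fs: vector_space fun_scale by (rule vector_space_fun_scale)
  interpret p: vector_space "prod_scale sA fun_scale"
    by (intro vector_space_prod_scale vs vector_space_fun_scale)
  have K: "vector_space ((*) :: 'k \<Rightarrow> 'k \<Rightarrow> 'k)" by unfold_locales (auto simp: algebra_simps)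
  interpret vk: vector_space_pair sV "(*)" using vs K by (auto simp: vector_space_pair_def)
  obtain S where S: "finite S" "a.span S = UNIV" using A by (auto simp: finite_dim_subspace_def)
  obtain E c where E: "finite E" "E \<subseteq> UNIV" and c: "\<And>e. linear_on sV (*) UNIV (c e)"
    and x: "\<forall>x\<in>UNIV. x = (\<Sum>e\<in>E. sV (c e x) e)"
    using finite_dim_subspace_coordinates[OF V] by metis
  have cd: "c e \<in> dual_space sV" for e
    using c by (simp add: dual_space_iff[OF vs(2)] linear_on_def)
  let ?G = "(\<lambda>x. (x, 0)) ` S \<union> (\<lambda>e. (0, c e)) ` E"
  have sub: "p.subspace (semidirect_carrier sV)"
    using dual_space_subspace[OF vs(2)] unfolding p.subspace_def fs.subspace_def semidirect_carrier_def
    by (auto simp: prod_scale_def zero_prod_def)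
  have "p.span ?G \<subseteq> semidirect_carrier sV"
    using cd fs.subspace_0[OF dual_space_subspace[OF vs(2)]]
    by (intro p.span_minimal sub) (auto simp: semidirect_carrier_def)
  moreover have "(y, f) \<in> p.span ?G" if "f \<in> dual_space sV" for y f
  proof -
    have "y \<in> a.span S" using S by auto
    then have 1: "(y, 0) \<in> p.span ?G"
    proof (induction rule: a.span_induct_alt)
      case base show ?case using p.span_zero[of ?G] by (simp only: zero_prod_def)
    next
      case (step k x y)
      have "(x, 0) \<in> p.span ?G" using step by (intro p.span_base) auto
      from p.span_add[OF p.span_scale[OF this, of k] step(2)]
      show ?case by (simp add: prod_scale_Pair fs.scale_zero_right[unfolded zero_fun_def])
    qed
    have "f = (\<Sum>e\<in>E. fun_scale (f e) (c e))"
    proof (rule ext)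
      fix x
      have "f x = f (\<Sum>e\<in>E. sV (c e x) e)" by (rule arg_cong[OF x[rule_format, OF UNIV_I]])
      also have "\<dots> = (\<Sum>e\<in>E. c e x * f e)"
        using that by (simp add: dual_space_def vk.linear_sum vk.linear_scale)
      finally show "f x = (\<Sum>e\<in>E. fun_scale (f e) (c e)) x"
        by (simp add: sum_fun_apply fun_scale_def mult.commute)
    qed
    then have "(0, f) = (\<Sum>e\<in>E. prod_scale sA fun_scale (f e) (0, c e))"
      by (simp add: prod_scale_Pair sum_prod)
    also have "\<dots> \<in> p.span ?G"
      by (intro p.span_sum p.span_scale p.span_base) auto
    finally show ?thesis using p.span_add[OF 1, of "(0, f)"] by simp
  qed
  ultimately have "p.span ?G = semidirect_carrier sV"
    by (auto simp: semidirect_carrier_def)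
  then show ?thesis
    using E(1) S(1) p.vector_space_axioms unfolding finite_dim_subspace_def
    by (intro conjI exI[of _ ?G]) simp_all
qed

lemma mock_lie_algebra_semidirect:
  fixes sA :: "'k::field_char_0 \<Rightarrow> 'a::ab_group_add \<Rightarrow> 'a" and sV :: "'k \<Rightarrow> 'v::ab_group_add \<Rightarrow> 'v"
  assumes A: "mock_lie_algebra sA UNIV mA" and V: "mock_lie_representation sA mA sV \<rho>"
  shows "mock_lie_algebra (prod_scale sA fun_scale) (semidirect_carrier sV) (semidirect_mult mA \<rho>)"
proof -
  have fd: "finite_dim_subspace sA UNIV" "finite_dim_subspace sV UNIV"
    using A V by (auto simp: mock_lie_algebra_def mock_lie_representation_def)
  have vs: "vector_space sA" "vector_space sV" using fd by (auto simp: finite_dim_subspace_def)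
  have K: "vector_space ((*) :: 'k \<Rightarrow> 'k \<Rightarrow> 'k)" by unfold_locales (auto simp: algebra_simps)
  interpret vk: vector_space_pair sV "(*)" using vs K by (auto simp: vector_space_pair_def)
  interpret av: vector_space_pair sA sV using vs by (auto simp: vector_space_pair_def)
  interpret vv: vector_space_pair sV sV using vs by (auto simp: vector_space_pair_def)
  have d: "f \<in> dual_space sV \<longleftrightarrow> (\<forall>x y. f (x + y) = f x + f y) \<and> (\<forall>c x. f (sV c x) = c * f x)" for f
    by (rule dual_space_iff[OF vs(2)])
  have dn: "f (- x) = - f x" "f (x - y) = f x - f y" if "f \<in> dual_space sV" for f x y
    using that by (auto simp: dual_space_def vk.linear_neg vk.linear_diff)
  have r: "\<rho> x (u + w) = \<rho> x u + \<rho> x w" "\<rho> x (sV k u) = sV k (\<rho> x u)"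
    "\<rho> (x + y) u = \<rho> x u + \<rho> y u" "\<rho> (sA k x) u = sV k (\<rho> x u)"
    "\<rho> (mA x y) u = - \<rho> x (\<rho> y u) - \<rho> y (\<rho> x u)" for x y u w k
    using V by (auto simp: mock_lie_representation_def linear_char linear_char)
  have a: "mA (x + y) z = mA x z + mA y z" "mA z (x + y) = mA z x + mA z y"
    "mA (sA k x) z = sA k (mA x z)" "mA z (sA k x) = sA k (mA z x)"
    "mA x (mA y z) + mA y (mA z x) + mA z (mA x y) = 0" for x y z k
    using A by (auto simp: mock_lie_algebra_def bilinear_on_def linear_on_def)
  have comm: "mA x y = mA y x" for x y using A by (auto simp: mock_lie_algebra_def)
  have closed: "semidirect_mult mA \<rho> x y \<in> semidirect_carrier sV"
    if "x \<in> semidirect_carrier sV" "y \<in> semidirect_carrier sV" for x y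
    using that by (auto simp: semidirect_mult_def semidirect_carrier_def d dual_rep_def r algebra_simps)
  have bil: "bilinear_on (prod_scale sA fun_scale) (prod_scale sA fun_scale)
    (semidirect_carrier sV) (semidirect_mult mA \<rho>)"
    by (auto simp: bilinear_on_def linear_on_def semidirect_mult_def semidirect_carrier_def d
        dual_rep_def r a prod_scale_def fun_scale_def fun_eq_iff algebra_simps)
  have sym: "semidirect_mult mA \<rho> x y = semidirect_mult mA \<rho> y x" for x y
    by (simp add: semidirect_mult_def comm[of "fst x"] add.commute)
  have jac: "semidirect_mult mA \<rho> x (semidirect_mult mA \<rho> y z)
      + semidirect_mult mA \<rho> y (semidirect_mult mA \<rho> z x)
      + semidirect_mult mA \<rho> z (semidirect_mult mA \<rho> x y) = 0"
    if "x \<in> semidirect_carrier sV" "y \<in> semidirect_carrier sV" "z \<in> semidirect_carrier sV" for x y z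
    using that
    by (auto simp: semidirect_mult_def semidirect_carrier_def a dual_rep_def r dn zero_prod_def fun_eq_iff)
  show ?thesis
    unfolding mock_lie_algebra_def
    using finite_dim_semidirect_carrier[OF fd] closed bil sym jac by blast
qed

end

theory Submission
  imports Defs
begin

text \<open>Write \<open>a\<^sub>i = T v\<^sub>i\<close>, \<open>b\<^sub>i = v\<^sub>i\<^sup>*\<close> and \<open>O\<^sub>i\<^sub>j = a\<^sub>i \<bullet> a\<^sub>j - T (\<rho>(a\<^sub>i) v\<^sub>j + \<rho>(a\<^sub>j) v\<^sub>i)\<close>.
  Since \<open>\<Sum>\<^sub>i a\<^sub>i \<otimes> \<rho>\<^sup>*(x) b\<^sub>i = \<Sum>\<^sub>i T (\<rho>(x) v\<^sub>i) \<otimes> b\<^sub>i\<close>, expanding the three leg products gives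
  \<open>[[r,r]] = \<Sum>\<^sub>i\<^sub>j (O\<^sub>i\<^sub>j \<otimes> b\<^sub>i \<otimes> b\<^sub>j + b\<^sub>i \<otimes> O\<^sub>i\<^sub>j \<otimes> b\<^sub>j + b\<^sub>i \<otimes> b\<^sub>j \<otimes> O\<^sub>i\<^sub>j)\<close>. The three kinds of
  summands lie in different components of the triple tensor product of \<open>A \<oplus> V\<^sup>*\<close> and the
  \<open>b\<^sub>i \<otimes> b\<^sub>j\<close> are independent, so this vanishes exactly when all \<open>O\<^sub>i\<^sub>j\<close> do, which by bilinearity
  is the identity defining \<open>\<O>\<close>-operators.\<close>

section \<open>Linear maps on a subspace\<close>

lemma linear_on_zero:
  fixes f :: "'b::monoid_add \<Rightarrow> 'w::group_add"
  assumes "linear_on s t B f" "0 \<in> B"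
  shows "f 0 = 0"
  using assms by (metis add.right_neutral add_left_cancel linear_on_def)

lemma linear_on_minus:
  fixes f :: "'b::group_add \<Rightarrow> 'w::group_add"
  assumes "linear_on s t B f" "0 \<in> B" "x \<in> B" "- x \<in> B"
  shows "f (- x) = - f x"
proof -
  have "f (x + - x) = f x + f (- x)" using assms(1,3,4) unfolding linear_on_def by blast
  then show ?thesis using linear_on_zero[OF assms(1,2)] by (simp add: eq_neg_iff_add_eq_0 minus_unique)
qed

text \<open>Unlike \<open>linear_on_sum_expand\<close>, the vectors form an indexed family, so
  repetitions are allowed and sums over \<open>{1..n}\<close> fit directly.\<close>

lemma linear_on_image_sum:
  assumes s: "finite_dim_subspace s B" and t: "vector_space t" and f: "linear_on s t B f"
    and I: "finite I" "\<And>i. i \<in> I \<Longrightarrow> w i \<in> B"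
  shows "f (\<Sum>i\<in>I. s (c i) (w i)) = (\<Sum>i\<in>I. t (c i) (f (w i)))"
proof -
  interpret s: vector_space s using s by (simp add: finite_dim_subspace_def)
  have B: "s.subspace B" using s by (auto simp: finite_dim_subspace_def)
  from I show ?thesis
  proof (induction I rule: finite_induct)
    case empty
    show ?case using linear_on_zero[OF f s.subspace_0[OF B]] by simp
  next
    case (insert i I)
    then have "s (c i) (w i) \<in> B" "(\<Sum>i\<in>I. s (c i) (w i)) \<in> B" "w i \<in> B"
      by (auto intro!: s.subspace_sum s.subspace_scale B)
    with insert f show ?case by (simp add: linear_on_def)
  qed
qed

section \<open>The semi-direct product with a fixed pair of dual bases\<close>

locale dual_basis_setting =
  fixes sA :: "'k::field_char_0 \<Rightarrow> 'a::ab_group_add \<Rightarrow> 'a"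
    and mA :: "'a \<Rightarrow> 'a \<Rightarrow> 'a"
    and sV :: "'k \<Rightarrow> 'v::ab_group_add \<Rightarrow> 'v"
    and \<rho> :: "'a \<Rightarrow> 'v \<Rightarrow> 'v"
    and T :: "'v \<Rightarrow> 'a"
    and n :: nat
    and v :: "nat \<Rightarrow> 'v"
    and v' :: "nat \<Rightarrow> ('v \<Rightarrow> 'k)"
  assumes alg: "mock_lie_algebra sA UNIV mA"
    and rep: "mock_lie_representation sA mA sV \<rho>"
    and T: "Vector_Spaces.linear sV sA T"
    and basis: "inj_on v {1..n}" "finite_dimensional_vector_space sV (v ` {1..n})"
    and dual_mem: "\<And>i. i \<in> {1..n} \<Longrightarrow> v' i \<in> dual_space sV"
    and dual_basis: "\<And>i j. i \<in> {1..n} \<Longrightarrow> j \<in> {1..n} \<Longrightarrow> v' i (v j) = (if i = j then 1 else 0)"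
begin

abbreviation "S \<equiv> prod_scale sA (fun_scale :: 'k \<Rightarrow> ('v \<Rightarrow> 'k) \<Rightarrow> _)"
abbreviation "B \<equiv> semidirect_carrier sV :: ('a \<times> ('v \<Rightarrow> 'k)) set"
abbreviation "mB \<equiv> semidirect_mult mA \<rho> :: 'a \<times> ('v \<Rightarrow> 'k) \<Rightarrow> _"
abbreviation "a i \<equiv> (T (v i), 0 :: 'v \<Rightarrow> 'k)"
abbreviation "b i \<equiv> (0 :: 'a, v' i)"

sublocale A: vector_space sA
  using alg by (auto simp: mock_lie_algebra_def finite_dim_subspace_def)

sublocale V: finite_dimensional_vector_space sV "v ` {1..n}"
  by (rule basis(2))

sublocale S: vector_space S
  by (intro vector_space_prod_scale vector_space_fun_scale A.vector_space_axioms)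

lemmas dual_iff = dual_space_iff[OF V.vector_space_axioms]

lemma T_simps: "T (x + y) = T x + T y" "T (sV c x) = sA c (T x)"
proof -
  interpret t: Vector_Spaces.linear sV sA T by (rule T)
  show "T (x + y) = T x + T y" "T (sV c x) = sA c (T x)"
    by (rule t.add t.scale)+
qed

lemma rep_simps: "\<rho> x (u + w) = \<rho> x u + \<rho> x w" "\<rho> x (sV k u) = sV k (\<rho> x u)"
    "\<rho> (x + y) u = \<rho> x u + \<rho> y u" "\<rho> (sA k x) u = sV k (\<rho> x u)"
  using rep by (auto simp: mock_lie_representation_def linear_char)

lemma mA_simps: "mA (x + y) z = mA x z + mA y z" "mA z (x + y) = mA z x + mA z y"
    "mA (sA k x) z = sA k (mA x z)" "mA z (sA k x) = sA k (mA z x)"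
  using alg by (auto simp: mock_lie_algebra_def bilinear_on_def linear_on_def)

lemma mA_zero: "mA x 0 = 0" "mA 0 x = 0"
  using mA_simps(1)[of 0 0 x] mA_simps(2)[of x 0 0] by simp_all

lemma rho_zero: "\<rho> 0 u = 0"
  using rep_simps(3)[of 0 0 u] by simp

lemma mB_alg: "mock_lie_algebra S B mB"
  by (rule mock_lie_algebra_semidirect[OF alg rep])

lemma B_fin: "finite_dim_subspace S B"
  using mB_alg by (simp add: mock_lie_algebra_def)

lemma B_subspace: "S.subspace B"
proof -
  obtain X where "S.span X = B" using B_fin by (auto simp: finite_dim_subspace_def)
  then show ?thesis using S.subspace_span by metis
qed

lemma zero_dual: "0 \<in> dual_space sV"
  by (simp add: dual_iff)

lemma A_mem: "(x, 0) \<in> B"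
  by (simp add: semidirect_carrier_def zero_dual)

lemma b_mem: "i \<in> {1..n} \<Longrightarrow> b i \<in> B"
  by (simp add: semidirect_carrier_def dual_mem)

section \<open>Expansions in the dual bases\<close>

lemma dual_sum:
  assumes "f \<in> dual_space sV"
  shows "f (\<Sum>i\<in>I. sV (c i) (w i)) = (\<Sum>i\<in>I. c i * f (w i))"
proof -
  interpret f: Vector_Spaces.linear sV "(*)" f using assms by (simp add: dual_space_def)
  show ?thesis by (simp add: f.sum f.scale)
qed

text \<open>Applying \<open>v' i\<close> to any expansion of \<open>u\<close> in the basis kills
  every term but the one at \<open>i\<close>, which identifies the coefficient.\<close>

lemma basis_expand: "u = (\<Sum>i\<in>{1..n}. sV (v' i u) (v i))"
proof -
  have "u \<in> V.span (v ` {1..n})" by (simp only: V.span_Basis UNIV_I)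
  then obtain c where "u = (\<Sum>w\<in>v ` {1..n}. sV (c w) w)"
    by (auto simp: V.span_finite)
  then have u: "u = (\<Sum>i\<in>{1..n}. sV (c (v i)) (v i))"
    by (simp add: sum.reindex[OF basis(1)] del: One_nat_def)
  have "v' i u = c (v i)" if i: "i \<in> {1..n}" for i
  proof -
    have "v' i u = (\<Sum>j\<in>{1..n}. c (v j) * v' i (v j))"
      by (subst u) (rule dual_sum[OF dual_mem[OF i]])
    also have "\<dots> = (\<Sum>j\<in>{1..n}. if i = j then c (v j) else 0)"
      by (intro sum.cong) (simp_all add: dual_basis[OF i])
    also have "\<dots> = c (v i)" using i by simp
    finally show ?thesis .
  qed
  then show ?thesis by (subst u) (intro sum.cong, simp_all)
qed

text \<open>The expansion is stated for pairs, so that maps that are linear in a slot from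
  \<open>B\<close> can be applied to it.\<close>

lemma T_expand: "(T u, 0) = (\<Sum>i\<in>{1..n}. S (v' i u) (a i))"
proof -
  interpret t: Vector_Spaces.linear sV sA T by (rule T)
  have "T u = (\<Sum>i\<in>{1..n}. sA (v' i u) (T (v i)))"
    by (subst basis_expand[of u]) (simp add: t.sum t.scale)
  moreover have "fun_scale c 0 = 0" for c :: 'k by (simp add: fun_scale_def fun_eq_iff)
  then have "(\<Sum>i\<in>{1..n}. fun_scale (v' i u) 0) = (0 :: 'v \<Rightarrow> 'k)"
    by (intro sum.neutral) blast
  ultimately show ?thesis by (simp add: prod_scale_Pair sum_prod del: One_nat_def)
qed

text \<open>Evaluated at \<open>u\<close>, this is \<open>f\<close> applied to
  \<open>basis_expand\<close>.\<close>

lemma dual_expand: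
  assumes "f \<in> dual_space sV"
  shows "(0, f) = (\<Sum>j\<in>{1..n}. S (f (v j)) (b j))"
proof -
  have "f = (\<Sum>j\<in>{1..n}. fun_scale (f (v j)) (v' j))"
  proof
    fix u
    have "f u = f (\<Sum>i\<in>{1..n}. sV (v' i u) (v i))" by (rule arg_cong[OF basis_expand])
    then show "f u = (\<Sum>j\<in>{1..n}. fun_scale (f (v j)) (v' j)) u"
      by (simp add: dual_sum[OF assms] sum_fun_apply fun_scale_def mult.commute)
  qed
  then show ?thesis by (simp add: prod_scale_Pair sum_prod)
qed

lemma dual_rep_mem: "f \<in> dual_space sV \<Longrightarrow> dual_rep \<rho> x f \<in> dual_space sV"
  by (auto simp: dual_iff dual_rep_def rep_simps)

text \<open>Both sides expand to the double sum of \<open>G (a i) (b j)\<close> weighted by the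
  matrix entries \<open>v' i (\<rho> x (v j))\<close>. A general \<open>G\<close> lets the action be
  moved between any two legs of a triple tensor.\<close>

lemma sum_dual_rep_eq_sum_rep:
  assumes t: "vector_space t" and G: "bilinear_on S t B G"
  shows "(\<Sum>i\<in>{1..n}. G (a i) (0, dual_rep \<rho> x (v' i))) = (\<Sum>i\<in>{1..n}. G (T (\<rho> x (v i)), 0) (b i))"
proof -
  have "G (a i) (0, dual_rep \<rho> x (v' i)) = (\<Sum>j\<in>{1..n}. t (v' i (\<rho> x (v j))) (G (a i) (b j)))"
    if i: "i \<in> {1..n}" for i
  proof -
    have lin: "linear_on S t B (G (a i))" using G A_mem by (simp add: bilinear_on_def)
    show ?thesis
      using arg_cong[OF dual_expand[OF dual_rep_mem[OF dual_mem[OF i]], of x], of "G (a i)"]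
        linear_on_image_sum[OF B_fin t lin finite_atLeastAtMost b_mem]
      by (simp only: dual_rep_def)
  qed
  then have "(\<Sum>i\<in>{1..n}. G (a i) (0, dual_rep \<rho> x (v' i)))
      = (\<Sum>i\<in>{1..n}. \<Sum>j\<in>{1..n}. t (v' i (\<rho> x (v j))) (G (a i) (b j)))"
    by (intro sum.cong refl)
  also have "\<dots> = (\<Sum>j\<in>{1..n}. \<Sum>i\<in>{1..n}. t (v' i (\<rho> x (v j))) (G (a i) (b j)))"
    by (rule sum.swap)
  also have "\<dots> = (\<Sum>j\<in>{1..n}. G (T (\<rho> x (v j)), 0) (b j))"
  proof (intro sum.cong refl)
    fix j assume j: "j \<in> {1..n}"
    have lin: "linear_on S t B (\<lambda>p. G p (b j))" using G b_mem[OF j] by (simp add: bilinear_on_def)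
    show "(\<Sum>i\<in>{1..n}. t (v' i (\<rho> x (v j))) (G (a i) (b j))) = G (T (\<rho> x (v j)), 0) (b j)"
      unfolding T_expand[of "\<rho> x (v j)"]
      by (rule linear_on_image_sum[OF B_fin t lin finite_atLeastAtMost A_mem, symmetric])
  qed
  finally show ?thesis .
qed

section \<open>The tensor \<open>r\<close> as a sum of pure tensors\<close>

abbreviation "T' \<equiv> \<Sum>i\<in>{1..n}. tens2 S B (a i) (b i)"
abbreviation "r \<equiv> T' - flip T'"
text \<open>At \<open>v i\<close> and \<open>v j\<close> this is the
  \<open>O\<^sub>i\<^sub>j\<close> of the outline.\<close>

abbreviation "defect x y \<equiv> mA (T x) (T y) - T (\<rho> (T x) y + \<rho> (T y) x)"
abbreviation "t3 \<equiv> tens3 S B"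

lemma tens2_minus_left:
  assumes "p \<in> B" "q \<in> B"
  shows "tens2 S B (- p) q = - tens2 S B p q"
proof -
  have "linear_on S fun_scale B (\<lambda>x. tens2 S B x q)"
    using tens2_bilinear[of S B] assms(2) by (auto simp: bilinear_on_def)
  from linear_on_minus[OF this S.subspace_0[OF B_subspace] assms(1) S.subspace_neg[OF B_subspace assms(1)]]
  show ?thesis .
qed

lemma flip_T': "flip T' = (\<Sum>i\<in>{1..n}. tens2 S B (b i) (a i))"
proof -
  have "flip T' = (\<Sum>i\<in>{1..n}. flip (tens2 S B (a i) (b i)))"
    by (simp add: flip_def fun_eq_iff sum_fun_apply)
  then show ?thesis by (simp add: flip_tens2)
qed

lemma flip_r: "r = - flip r"
  by (simp add: flip_def fun_eq_iff)

text \<open>The sign of the second half of \<open>r\<close> is absorbed into the left factors, because the formulas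
  for the leg products apply to plain sums of pure tensors.\<close>

definition lft :: "nat + nat \<Rightarrow> 'a \<times> ('v \<Rightarrow> 'k)" where
  "lft = case_sum a (\<lambda>i. - b i)"

definition rgt :: "nat + nat \<Rightarrow> 'a \<times> ('v \<Rightarrow> 'k)" where
  "rgt = case_sum b a"

lemma r_sum: "r = (\<Sum>i\<in>{1..n} <+> {1..n}. tens2 S B (lft i) (rgt i))"
proof -
  have "(\<Sum>i\<in>{1..n}. tens2 S B (- b i) (a i)) = - (\<Sum>i\<in>{1..n}. tens2 S B (b i) (a i))"
    unfolding sum_negf[symmetric]
    by (intro sum.cong refl tens2_minus_left b_mem A_mem)
  then show ?thesis unfolding flip_T' by (simp add: sum.Plus lft_def rgt_def)
qed

lemma lft_rgt_mem:
  assumes "i \<in> {1..n} <+> {1..n}"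
  shows "lft i \<in> B \<and> rgt i \<in> B"
proof -
  have "- b j \<in> B" if "j \<in> {1..n}" for j
    using S.subspace_neg[OF B_subspace b_mem[OF that]] .
  then show ?thesis using assms A_mem b_mem by (auto simp: lft_def rgt_def)
qed

lemma r_mem: "r \<in> tensor_square S B"
proof -
  interpret fs: vector_space fun_scale by (rule vector_space_fun_scale)
  show ?thesis
    unfolding r_sum tensor_square_def
    by (intro fs.span_sum fs.span_base) (use lft_rgt_mem in blast)
qed

section \<open>Slotwise rules for triple tensors and products in \<open>B\<close>\<close>

lemma t3_linear:
  assumes "p \<in> B" "q \<in> B"
  shows "linear_on S fun_scale B (\<lambda>x. t3 x p q)" "linear_on S fun_scale B (\<lambda>x. t3 p x q)"
    "linear_on S fun_scale B (\<lambda>x. t3 p q x)"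
  using tens3_trilinear[of S B] assms by (auto simp: trilinear_on_def)

lemma t3_minus:
  assumes "x \<in> B" "p \<in> B" "q \<in> B"
  shows "t3 (- x) p q = - t3 x p q" "t3 p (- x) q = - t3 p x q" "t3 p q (- x) = - t3 p q x"
  using t3_linear[OF assms(2,3), THEN linear_on_minus, OF S.subspace_0[OF B_subspace] assms(1)
    S.subspace_neg[OF B_subspace assms(1)]] .

lemma t3_zero:
  assumes "p \<in> B" "q \<in> B"
  shows "t3 0 p q = 0" "t3 p 0 q = 0" "t3 p q 0 = 0"
  using t3_linear[OF assms, THEN linear_on_zero, OF S.subspace_0[OF B_subspace]] .

lemma t3_defect:
  assumes "p \<in> B" "q \<in> B"
  shows
    "t3 (defect x y, 0) p q = t3 (mA (T x) (T y), 0) p q - t3 (T (\<rho> (T x) y), 0) p q - t3 (T (\<rho> (T y) x), 0) p q"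
    "t3 p (defect x y, 0) q = t3 p (mA (T x) (T y), 0) q - t3 p (T (\<rho> (T x) y), 0) q - t3 p (T (\<rho> (T y) x), 0) q"
    "t3 p q (defect x y, 0) = t3 p q (mA (T x) (T y), 0) - t3 p q (T (\<rho> (T x) y), 0) - t3 p q (T (\<rho> (T y) x), 0)"
proof -
  have *: "f (defect x y, 0) = f (mA (T x) (T y), 0) - f (T (\<rho> (T x) y), 0) - f (T (\<rho> (T y) x), 0)"
    if f: "linear_on S fun_scale B f" for f :: "_ \<Rightarrow> ('a \<times> ('v \<Rightarrow> 'k), 'k) tensor3"
  proof -
    have add: "f (z + w, 0) = f (z, 0) + f (w, 0)" for z w
      using f A_mem[of z] A_mem[of w] by (force simp: linear_on_def)
    \<comment> \<open>The subtracted terms are moved to the left, where additivity of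
      \<open>f\<close> alone suffices.\<close>
    have "f (defect x y, 0) + f (T (\<rho> (T x) y), 0) + f (T (\<rho> (T y) x), 0) = f (mA (T x) (T y), 0)"
      unfolding add[symmetric] by (simp add: T_simps)
    then show ?thesis unfolding eq_diff_eq by (simp only: ac_simps)
  qed
  from t3_linear[OF assms, THEN *]
  show "t3 (defect x y, 0) p q = t3 (mA (T x) (T y), 0) p q - t3 (T (\<rho> (T x) y), 0) p q - t3 (T (\<rho> (T y) x), 0) p q"
    "t3 p (defect x y, 0) q = t3 p (mA (T x) (T y), 0) q - t3 p (T (\<rho> (T x) y), 0) q - t3 p (T (\<rho> (T y) x), 0) q"
    "t3 p q (defect x y, 0) = t3 p q (mA (T x) (T y), 0) - t3 p q (T (\<rho> (T x) y), 0) - t3 p q (T (\<rho> (T y) x), 0)" .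
qed

lemma dual_zero: "f \<in> dual_space sV \<Longrightarrow> f 0 = 0"
  using dual_sum[of f _ _ "{} :: nat set"] by simp

text \<open>The last rule is conditional because \<open>dual_rep \<rho> 0 f\<close> is the constant
  function \<open>f 0\<close>, which is zero for linear \<open>f\<close>.\<close>

lemma mB_simps:
  "mB (x, 0) (y, 0) = (mA x y, 0)"
  "mB (x, 0) (0, f) = (0, dual_rep \<rho> x f)"
  "mB (0, f) (x, 0) = (0, dual_rep \<rho> x f)"
  "f \<in> dual_space sV \<Longrightarrow> g \<in> dual_space sV \<Longrightarrow> mB (0, f) (0, g) = 0"
  by (auto simp: semidirect_mult_def dual_rep_def fun_eq_iff mA_zero rho_zero dual_zero zero_prod_def)

lemma mB_minus:
  assumes "p \<in> B" "q \<in> B"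
  shows "mB (- p) q = - mB p q" "mB p (- q) = - mB p q"
proof -
  have "linear_on S S B (\<lambda>p. mB p q)" "linear_on S S B (mB p)"
    using mult_bilin[OF mB_alg] assms by (auto simp: bilinear_on_def)
  then show "mB (- p) q = - mB p q" "mB p (- q) = - mB p q"
    using linear_on_minus S.subspace_0[OF B_subspace] S.subspace_neg[OF B_subspace] assms by metis+
qed

lemma dual_rep_B_mem: "f \<in> dual_space sV \<Longrightarrow> (0, dual_rep \<rho> x f) \<in> B"
  by (simp add: semidirect_carrier_def dual_rep_mem)

section \<open>Expansion of the Yang-Baxter expression\<close>

text \<open>The six sums with a \<open>dual_rep\<close> leg become sums with a
  \<open>T (\<rho> ...)\<close> leg by \<open>sum_dual_rep_eq_sum_rep\<close>. Two of them land in
  each slot and combine with the \<open>mA\<close> sum of that slot to give the defect.\<close>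

lemma yang_baxter_r:
  "yang_baxter S B mB r = (\<Sum>i\<in>{1..n}. \<Sum>j\<in>{1..n}.
     t3 (defect (v i) (v j), 0) (b i) (b j) + t3 (b i) (defect (v i) (v j), 0) (b j)
     + t3 (b i) (b j) (defect (v i) (v j), 0))"
proof -
  let ?I = "{1..n}"
  let ?L = "\<lambda>i j. (T (\<rho> (T (v i)) (v j)), 0 :: 'v \<Rightarrow> 'k)"
  let ?R = "\<lambda>i j. (0 :: 'a, dual_rep \<rho> (T (v i)) (v' j))"
  let ?M = "\<lambda>i j. (mA (T (v i)) (T (v j)), 0 :: 'v \<Rightarrow> 'k)"
  have fin: "finite ({1..n} <+> {1..n})" by simp
  note mem = A_mem b_mem dual_rep_B_mem[OF dual_mem] S.subspace_neg[OF B_subspace] S.subspace_0[OF B_subspace]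
  note simps = sum.Plus lft_def rgt_def mB_simps mB_minus t3_minus t3_zero dual_mem mem sum.distrib sum_negf
    sum_subtractf
  \<comment> \<open>Each leg product splits into four blocks, by the two halves of \<open>r\<close>
    in either factor. The block multiplying two covectors vanishes, leaving one \<open>?M\<close>
    sum and two \<open>?R\<close> sums.\<close>
  have 1: "r12_r13 S B mB r = (\<Sum>i\<in>?I. \<Sum>j\<in>?I. t3 (?M i j) (b i) (b j))
      - (\<Sum>i\<in>?I. \<Sum>j\<in>?I. t3 (?R i j) (b i) (a j)) - (\<Sum>i\<in>?I. \<Sum>j\<in>?I. t3 (?R j i) (a i) (b j))"
    unfolding r_sum
    by (rule trans[OF r12_r13_sum[OF mB_alg fin lft_rgt_mem]], assumption)
      (simp add: simps del: One_nat_def uminus_Pair)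
  have 2: "r13_r23 S B mB r = (\<Sum>i\<in>?I. \<Sum>j\<in>?I. t3 (b i) (b j) (?M i j))
      - (\<Sum>i\<in>?I. \<Sum>j\<in>?I. t3 (a i) (b j) (?R j i)) - (\<Sum>i\<in>?I. \<Sum>j\<in>?I. t3 (b i) (a j) (?R i j))"
    unfolding r_sum
    by (rule trans[OF r13_r23_sum[OF mB_alg fin lft_rgt_mem]], assumption)
      (simp add: simps del: One_nat_def uminus_Pair)
  have 3: "r12_r23 S B mB r = (\<Sum>i\<in>?I. \<Sum>j\<in>?I. t3 (a i) (?R j i) (b j))
      - (\<Sum>i\<in>?I. \<Sum>j\<in>?I. t3 (b i) (?M i j) (b j)) + (\<Sum>i\<in>?I. \<Sum>j\<in>?I. t3 (b i) (?R i j) (a j))"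
    unfolding r_sum
    by (rule trans[OF r12_r23_sum[OF mB_alg fin lft_rgt_mem]], assumption)
      (simp add: simps del: One_nat_def uminus_Pair)
  have vs: "vector_space (fun_scale :: 'k \<Rightarrow> ('a \<times> ('v \<Rightarrow> 'k), 'k) tensor3 \<Rightarrow> _)"
    by (rule vector_space_fun_scale)
  \<comment> \<open>Fixing one leg leaves a bilinear map of the other two, listed here for each
    position and order.\<close>
  have bil: "bilinear_on S fun_scale B (\<lambda>x y. t3 x y p)" "bilinear_on S fun_scale B (\<lambda>x y. t3 y x p)"
    "bilinear_on S fun_scale B (\<lambda>x y. t3 x p y)" "bilinear_on S fun_scale B (\<lambda>x y. t3 y p x)"
    "bilinear_on S fun_scale B (\<lambda>x y. t3 p x y)" "bilinear_on S fun_scale B (\<lambda>x y. t3 p y x)"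
    if "p \<in> B" for p
    using that t3_linear by (auto simp: bilinear_on_def)
  note ex = bil[OF b_mem, THEN sum_dual_rep_eq_sum_rep[OF vs]]
  \<comment> \<open>Here and below, the swaps make the index shared by the \<open>a\<close> leg and
    the \<open>?R\<close> leg the inner one, which is the sum that \<open>ex\<close>
    rewrites.\<close>
  have 4: "(\<Sum>i\<in>?I. \<Sum>j\<in>?I. t3 (?R i j) (b i) (a j)) = (\<Sum>i\<in>?I. \<Sum>j\<in>?I. t3 (b i) (b j) (?L j i))"
    by (subst (2) sum.swap) (intro sum.cong refl ex)
  have 5: "(\<Sum>i\<in>?I. \<Sum>j\<in>?I. t3 (?R j i) (a i) (b j)) = (\<Sum>i\<in>?I. \<Sum>j\<in>?I. t3 (b i) (?L j i) (b j))"
    by (subst (1 2) sum.swap) (intro sum.cong refl ex)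
  have 6: "(\<Sum>i\<in>?I. \<Sum>j\<in>?I. t3 (a i) (b j) (?R j i)) = (\<Sum>i\<in>?I. \<Sum>j\<in>?I. t3 (?L i j) (b i) (b j))"
    by (subst (1) sum.swap) (intro sum.cong refl ex)
  have 7: "(\<Sum>i\<in>?I. \<Sum>j\<in>?I. t3 (b i) (a j) (?R i j)) = (\<Sum>i\<in>?I. \<Sum>j\<in>?I. t3 (b i) (?L i j) (b j))"
    by (intro sum.cong refl ex)
  have 8: "(\<Sum>i\<in>?I. \<Sum>j\<in>?I. t3 (a i) (?R j i) (b j)) = (\<Sum>i\<in>?I. \<Sum>j\<in>?I. t3 (?L j i) (b i) (b j))"
    by (subst (1 2) sum.swap) (intro sum.cong refl ex)
  have 9: "(\<Sum>i\<in>?I. \<Sum>j\<in>?I. t3 (b i) (?R i j) (a j)) = (\<Sum>i\<in>?I. \<Sum>j\<in>?I. t3 (b i) (b j) (?L i j))"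
    by (intro sum.cong refl ex)
  have "(\<Sum>i\<in>?I. \<Sum>j\<in>?I.
     t3 (defect (v i) (v j), 0) (b i) (b j) + t3 (b i) (defect (v i) (v j), 0) (b j)
     + t3 (b i) (b j) (defect (v i) (v j), 0))
    = (\<Sum>i\<in>?I. \<Sum>j\<in>?I.
     t3 (?M i j) (b i) (b j) - t3 (?L i j) (b i) (b j) - t3 (?L j i) (b i) (b j)
     + (t3 (b i) (?M i j) (b j) - t3 (b i) (?L i j) (b j) - t3 (b i) (?L j i) (b j))
     + (t3 (b i) (b j) (?M i j) - t3 (b i) (b j) (?L i j) - t3 (b i) (b j) (?L j i)))"
    by (intro sum.cong refl) (simp only: t3_defect b_mem)
  then show ?thesis
    unfolding yang_baxter_def 1 2 3 4 5 6 7 8 9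
    by (simp add: sum.distrib sum_subtractf del: One_nat_def)
qed

section \<open>Comparison with the identity for O-operators\<close>

lemma skew_symmetric_MLYBE_solution_r_iff:
  "skew_symmetric_MLYBE_solution S B mB r \<longleftrightarrow> yang_baxter S B mB r = 0"
  using r_mem flip_r unfolding skew_symmetric_MLYBE_solution_def by blast

text \<open>The defect is bilinear, so its values on pairs of basis vectors determine it.\<close>

lemma defect_expand:
  "defect x y = (\<Sum>i\<in>{1..n}. \<Sum>j\<in>{1..n}. sA (v' i x * v' j y) (defect (v i) (v j)))"
proof -
  have add: "defect (x + x') y = defect x y + defect x' y" "defect y (x + x') = defect y x + defect y x'"
    and scale: "defect (sV c x) y = sA c (defect x y)" "defect y (sV c x) = sA c (defect y x)" for x x' y c
    by (simp_all add: T_simps rep_simps mA_simps A.scale_right_diff_distrib A.scale_right_distrib algebra_simps)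
  have lin: "linear_on sV sA UNIV (\<lambda>x. defect x y)" "linear_on sV sA UNIV (defect x)" for x y
    by (simp_all only: linear_on_def add scale) simp_all
  have V: "finite_dim_subspace sV UNIV" using rep by (simp add: mock_lie_representation_def)
  note sum = linear_on_image_sum[OF V A.vector_space_axioms lin(1)] linear_on_image_sum[OF V A.vector_space_axioms lin(2)]
  have "defect x y = defect (\<Sum>i\<in>{1..n}. sV (v' i x) (v i)) y"
    by (rule arg_cong[OF basis_expand])
  also have "\<dots> = (\<Sum>i\<in>{1..n}. sA (v' i x) (defect (v i) y))"
    by (rule sum) simp_all
  also have "\<dots> = (\<Sum>i\<in>{1..n}. sA (v' i x) (defect (v i) (\<Sum>j\<in>{1..n}. sV (v' j y) (v j))))"
    by (intro sum.cong refl arg_cong[OF basis_expand])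
  also have "\<dots> = (\<Sum>i\<in>{1..n}. sA (v' i x) (\<Sum>j\<in>{1..n}. sA (v' j y) (defect (v i) (v j))))"
    by (intro sum.cong refl arg_cong[of _ _ "sA _"] sum) simp_all
  finally show ?thesis by (simp add: A.scale_sum_right)
qed

lemma O_operator_iff:
  "O_operator sA mA sV \<rho> T \<longleftrightarrow> (\<forall>i\<in>{1..n}. \<forall>j\<in>{1..n}. defect (v i) (v j) = 0)"
proof
  assume "O_operator sA mA sV \<rho> T"
  then show "\<forall>i\<in>{1..n}. \<forall>j\<in>{1..n}. defect (v i) (v j) = 0" by (simp add: O_operator_def)
next
  assume *: "\<forall>i\<in>{1..n}. \<forall>j\<in>{1..n}. defect (v i) (v j) = 0"
  have "defect x y = 0" for x y
    unfolding defect_expand[of x y] using * by (intro sum.neutral ballI) (metis A.scale_zero_right)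
  then show "O_operator sA mA sV \<rho> T" using T by (simp add: O_operator_def)
qed

text \<open>For the direct implication, a trilinear test form reads off each coordinate of each
  basis defect from \<open>yang_baxter_r\<close>.\<close>

lemma yang_baxter_zero_iff:
  "yang_baxter S B mB r = 0 \<longleftrightarrow> (\<forall>i\<in>{1..n}. \<forall>j\<in>{1..n}. defect (v i) (v j) = 0)"
proof
  assume *: "\<forall>i\<in>{1..n}. \<forall>j\<in>{1..n}. defect (v i) (v j) = 0"
  have "(0 :: 'a, 0 :: 'v \<Rightarrow> 'k) = 0" by (simp add: zero_prod_def)
  then show "yang_baxter S B mB r = 0"
    unfolding yang_baxter_r using * b_mem by (intro sum.neutral ballI) (simp only: t3_zero add_0)
next
  assume yb: "yang_baxter S B mB r = 0"
  have A: "finite_dim_subspace sA UNIV" using alg by (simp add: mock_lie_algebra_def)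
  obtain E c where c: "\<And>e. linear_on sA (*) UNIV (c e)" and x: "\<And>x. x = (\<Sum>e\<in>E. sA (c e x) e)"
    using finite_dim_subspace_coordinates[OF A] by (metis UNIV_I)
  show "\<forall>i\<in>{1..n}. \<forall>j\<in>{1..n}. defect (v i) (v j) = 0"
  proof (intro ballI)
    fix k l assume k: "k \<in> {1..n}" and l: "l \<in> {1..n}"
    \<comment> \<open>By \<open>x\<close>, a vector of \<open>A\<close> on which every coordinate
      functional \<open>c e\<close> vanishes is zero.\<close>
    have "c e (defect (v k) (v l)) = 0" for e
    proof -
      \<comment> \<open>\<open>\<phi>\<close> vanishes on the components \<open>V\<^sup>* \<otimes> A \<otimes> V\<^sup>*\<close> and \<open>V\<^sup>* \<otimes> V\<^sup>* \<otimes> A\<close>.\<close>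
      define \<phi> :: "'a \<times> ('v \<Rightarrow> 'k) \<Rightarrow> 'a \<times> ('v \<Rightarrow> 'k) \<Rightarrow> 'a \<times> ('v \<Rightarrow> 'k) \<Rightarrow> 'k"
        where "\<phi> p q w = c e (fst p) * snd q (v k) * snd w (v l)" for p q w
      have tri: "trilinear_on S (*) B \<phi>"
        using c[of e] by (auto simp: trilinear_on_def linear_on_def \<phi>_def prod_scale_def fun_scale_def algebra_simps)
      have "0 = yang_baxter S B mB r \<phi>" unfolding yb by simp
      also have "\<dots> = (\<Sum>i\<in>{1..n}. \<Sum>j\<in>{1..n}. c e (defect (v i) (v j)) * v' i (v k) * v' j (v l))"
        \<comment> \<open>In the other two kinds of summands the first leg is a covector
          \<open>b i\<close>, whose \<open>A\<close> component is 0, and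
          \<open>c e 0 = 0\<close>.\<close>
        unfolding yang_baxter_r using linear_on_zero[OF c[of e]]
        by (simp add: sum_fun_apply tens3_def tri) (simp add: \<phi>_def)
      \<comment> \<open>With the two Kronecker deltas nested, the inner sum collapses to
        \<open>j = l\<close> and then the outer one to \<open>i = k\<close>.\<close>
      also have "\<dots> = (\<Sum>i\<in>{1..n}. \<Sum>j\<in>{1..n}.
          if j = l then (if i = k then c e (defect (v i) (v j)) else 0) else 0)"
        by (intro sum.cong refl) (simp add: dual_basis[OF _ k] dual_basis[OF _ l] del: One_nat_def)
      also have "\<dots> = c e (defect (v k) (v l))"
        using k l by (simp del: One_nat_def)
      finally show ?thesis by simp
    qed
    then show "defect (v k) (v l) = 0" by (subst x) simp
  qed
qed

end

theorem theorem5p4: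
  fixes sA :: "'k::field_char_0 \<Rightarrow> 'a::ab_group_add \<Rightarrow> 'a"
    and mA :: "'a \<Rightarrow> 'a \<Rightarrow> 'a"
    and sV :: "'k \<Rightarrow> 'v::ab_group_add \<Rightarrow> 'v"
    and \<rho> :: "'a \<Rightarrow> 'v \<Rightarrow> 'v"
    and T :: "'v \<Rightarrow> 'a"
    and n :: nat
    and v :: "nat \<Rightarrow> 'v"
    and v' :: "nat \<Rightarrow> ('v \<Rightarrow> 'k)"
    and S :: "'k \<Rightarrow> 'a \<times> ('v \<Rightarrow> 'k) \<Rightarrow> 'a \<times> ('v \<Rightarrow> 'k)"
    and B :: "('a \<times> ('v \<Rightarrow> 'k)) set"
    and mB :: "'a \<times> ('v \<Rightarrow> 'k) \<Rightarrow> 'a \<times> ('v \<Rightarrow> 'k) \<Rightarrow> 'a \<times> ('v \<Rightarrow> 'k)"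
    and T' r :: "('a \<times> ('v \<Rightarrow> 'k), 'k) tensor2"
  assumes "mock_lie_algebra sA UNIV mA"
    and "mock_lie_representation sA mA sV \<rho>"
    and "Vector_Spaces.linear sV sA T"
    and basis: "inj_on v {1..n}" "finite_dimensional_vector_space sV (v ` {1..n})"
    and dual_basis: "\<And>i. i \<in> {1..n} \<Longrightarrow> v' i \<in> dual_space sV"
      "\<And>i j. i \<in> {1..n} \<Longrightarrow> j \<in> {1..n} \<Longrightarrow> v' i (v j) = (if i = j then 1 else 0)"
  defines "S \<equiv> prod_scale sA fun_scale"
    and "B \<equiv> semidirect_carrier sV"
    and "mB \<equiv> semidirect_mult mA \<rho>"
  defines "T' \<equiv> (\<Sum>i\<in>{1..n}. tens2 S B (T (v i), 0) (0, v' i))"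
  defines "r \<equiv> T' - flip T'"
  shows "skew_symmetric_MLYBE_solution S B mB r \<longleftrightarrow> O_operator sA mA sV \<rho> T"
proof -
  interpret dual_basis_setting sA mA sV \<rho> T n v v'
    by (rule dual_basis_setting.intro) (fact assms)+
  show ?thesis
    unfolding r_def T'_def S_def B_def mB_def
    using skew_symmetric_MLYBE_solution_r_iff yang_baxter_zero_iff O_operator_iff by blast
qed

end
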